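(* Every cube in $\mathcal{C}^3_3(v,1,0)$ is equivalent to the cube $I$ defined by $I(x,y,z)=1$ if $x=y=z$ and $I(x,y,z)=0$ otherwise, for $x,y,z\in\{1,\dots,v\}$.
   Context: A $v\times v\times v$ array is a function on $\{1,\dots,v\}^3$. A layer is a 2-dimensional subarray obtained by fixing one of the three coordinates. Two layers are parallel if they fix the same coordinate, to different values; their scalar product is the sum over all positions of the product of corresponding entries. $\mathcal{C}^3_3(v,k,\lambda)$ is the set of $v\times v\times v$ arrays over $\{0,1\}$ such that every layer (in each of the three directions) contains exactly $k$ ones and every two parallel layers have scalar product $\lambda$. Two cubes are equivalent if one can be transformed into the other by isotopy (permuting the symbols $\{1,\dots,v\}$ independently in each of the three coordinates) and conjugation (permuting the order of the three coordinates). *)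

theory Defs
  imports
    "HOL-Library.FuncSet"
    "HOL-Combinatorics.Permutations"
    "HOL-Analysis.Finite_Cartesian_Product"
begin

text \<open>
  A position of a \<open>v \<times> v \<times> v\<close> array is a vector \<open>p :: nat ^ 3\<close> with entries in \<open>{1..v}\<close>; the three
  coordinates are indexed by the three-element type \<open>3\<close>, with elements 1, 2 and 3.
\<close>

type_synonym pos = "nat ^ 3"

definition grid :: "nat \<Rightarrow> pos set" where
  "grid v = {p. \<forall>i. p $ i \<in> {1..v}}"

definition layer :: "nat \<Rightarrow> 3 \<Rightarrow> nat \<Rightarrow> pos set" where
  "layer v d a = {p \<in> grid v. p $ d = a}"

text \<open>
  The entry of the parallel layer \<open>b\<close> that corresponds to the entry at \<open>p\<close> of layer \<open>a\<close> is found by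
  replacing the fixed coordinate \<open>d\<close> of \<open>p\<close> by \<open>b\<close>.
\<close>

definition layer_product :: "nat \<Rightarrow> (pos \<Rightarrow> nat) \<Rightarrow> 3 \<Rightarrow> nat \<Rightarrow> nat \<Rightarrow> nat" where
  "layer_product v A d a b =
     (\<Sum>p\<in>layer v d a. A p * A (\<chi> i. if i = d then b else p $ i))"

text \<open>
  The set written \<open>\<C>\<^sup>3\<^sub>3(v,k,\<lambda>)\<close>. Arrays are extensional functions (\<open>undefined\<close> outside the grid), so
  that equality of elements is equality of arrays.
\<close>

definition cubes :: "nat \<Rightarrow> nat \<Rightarrow> nat \<Rightarrow> (pos \<Rightarrow> nat) set" where
  "cubes v k l =
     {A \<in> grid v \<rightarrow>\<^sub>E {0, 1}.
        (\<forall>d. \<forall>a\<in>{1..v}. card {p \<in> layer v d a. A p = 1} = k) \<and>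
        (\<forall>d. \<forall>a\<in>{1..v}. \<forall>b\<in>{1..v}. a \<noteq> b \<longrightarrow> layer_product v A d a b = l)}"

definition isotope :: "nat \<Rightarrow> (3 \<Rightarrow> nat \<Rightarrow> nat) \<Rightarrow> (pos \<Rightarrow> nat) \<Rightarrow> (pos \<Rightarrow> nat)" where
  "isotope v \<pi> A = (\<lambda>p\<in>grid v. A (\<chi> i. \<pi> i (p $ i)))"

definition conjugate :: "nat \<Rightarrow> (3 \<Rightarrow> 3) \<Rightarrow> (pos \<Rightarrow> nat) \<Rightarrow> (pos \<Rightarrow> nat)" where
  "conjugate v \<sigma> A = (\<lambda>p\<in>grid v. A (\<chi> i. p $ \<sigma> i))"

text \<open>
  Conjugations normalize the group of isotopies, so one conjugation followed by one isotopy accounts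
  for every transformation composed of isotopies and conjugations.
\<close>

definition equivalent :: "nat \<Rightarrow> (pos \<Rightarrow> nat) \<Rightarrow> (pos \<Rightarrow> nat) \<Rightarrow> bool" where
  "equivalent v A B \<longleftrightarrow>
     (\<exists>\<pi> \<sigma>. (\<forall>i. \<pi> i permutes {1..v}) \<and> \<sigma> permutes UNIV \<and>
            B = isotope v \<pi> (conjugate v \<sigma> A))"

definition diagonal_cube :: "nat \<Rightarrow> pos \<Rightarrow> nat" where
  "diagonal_cube v = (\<lambda>p\<in>grid v. if p $ 1 = p $ 2 \<and> p $ 2 = p $ 3 then 1 else 0)"

end

theory Submission
  imports Defs "HOL-Analysis.Cartesian_Space"
begin

text \<open>
  Let \<open>q x\<close> be the position of the only one in the layer on which the first coordinate is \<open>x\<close>.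
  A layer in direction \<open>i\<close> contains just one one, so \<open>x \<mapsto> q x $ i\<close> is injective, hence a
  permutation, for each \<open>i\<close>. Relabelling the symbols by these permutations moves the ones to the
  diagonal. No conjugation is needed.
\<close>

lemma cubes_one_unique:
  assumes "A \<in> cubes v 1 l" and "a \<in> {1..v}"
  shows "\<exists>!p. p \<in> layer v d a \<and> A p = 1"
proof -
  have "card {p \<in> layer v d a. A p = 1} = 1"
    using assms unfolding cubes_def by blast
  then obtain p where "{p \<in> layer v d a. A p = 1} = {p}"
    by (auto simp: card_1_singleton_iff)
  then have "p' \<in> layer v d a \<and> A p' = 1 \<longleftrightarrow> p' = p" for p'
    by auto
  then show ?thesis
    by simp
qed

text \<open>Extensionality of \<open>A\<close> matters: off the grid both sides are
  \<open>undefined\<close>.\<close>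

lemma conjugate_id:
  assumes "A \<in> grid v \<rightarrow>\<^sub>E S"
  shows "conjugate v id A = A"
  using assms by (auto simp: conjugate_def fun_eq_iff PiE_def extensional_def)

text \<open>An injective self-map of a finite set is onto; the identity branch is there because
  \<open>permutes\<close> demands fixed points outside \<open>S\<close>.\<close>

lemma inj_on_imp_permutes:
  assumes "inj_on f S" and "f ` S \<subseteq> S" and "finite S"
  shows "(\<lambda>x. if x \<in> S then f x else x) permutes S"
proof (rule bij_imp_permutes)
  have "f ` S = S"
    using assms by (simp add: endo_inj_surj)
  then have "bij_betw f S S"
    using assms(1) by (simp add: bij_betw_def)
  then show "bij_betw (\<lambda>x. if x \<in> S then f x else x) S S"
    by (simp cong: bij_betw_cong)
qed simp

theorem proposition2p6:
  fixes v :: nat and A :: "nat ^ 3 \<Rightarrow> nat"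
  assumes "A \<in> cubes v 1 0"
  shows "equivalent v A (diagonal_cube v)"
proof -
  have A: "A \<in> grid v \<rightarrow>\<^sub>E {0, 1}"
    using assms by (simp add: cubes_def)
  have same: "p = p'"
    if "p \<in> grid v" "p' \<in> grid v" "A p = 1" "A p' = 1" "p $ d = p' $ d" for p p' d
  proof -
    have "p $ d \<in> {1..v}"
      using that(1) by (simp add: grid_def)
    from cubes_one_unique[OF assms this, of d] show ?thesis
      using that by (auto simp: layer_def)
  qed
  have "\<forall>x\<in>{1..v}. \<exists>p. p \<in> layer v 1 x \<and> A p = 1"
    using cubes_one_unique[OF assms] by blast
  then obtain q where q: "q x \<in> layer v 1 x" "A (q x) = 1" if "x \<in> {1..v}" for x
    by metis
  have q_grid: "q x \<in> grid v" and q_1: "q x $ 1 = x" if "x \<in> {1..v}" for x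
    using q(1)[OF that] by (auto simp: layer_def)
  \<comment> \<open>\<open>isotope\<close> reads \<open>A\<close> at the relabelled position, so
    this choice puts the entry of \<open>A\<close> at \<open>q x\<close> on the diagonal position
    with all coordinates \<open>x\<close>.\<close>
  define \<pi> where "\<pi> = (\<lambda>i x. if x \<in> {1..v} then q x $ i else x)"
  have perm: "\<pi> i permutes {1..v}" for i
    unfolding \<pi>_def
  proof (rule inj_on_imp_permutes)
    \<comment> \<open>If \<open>q x\<close> and \<open>q y\<close> agree in coordinate
      \<open>i\<close>, they coincide by \<open>same\<close>, and their first coordinates give
      \<open>x = y\<close>.\<close>
    show "inj_on (\<lambda>x. q x $ i) {1..v}"
      by (rule inj_onI) (metis same q(2) q_grid q_1)
    show "(\<lambda>x. q x $ i) ` {1..v} \<subseteq> {1..v}"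
      using q_grid unfolding grid_def by blast
  qed simp
  have ones: "A (\<chi> i. \<pi> i (p $ i)) = (if p $ 1 = p $ 2 \<and> p $ 2 = p $ 3 then 1 else 0)"
    if p: "p \<in> grid v" for p
  proof -
    let ?r = "\<chi> i. \<pi> i (p $ i)"
    have p_in: "p $ i \<in> {1..v}" for i
      using p by (simp add: grid_def)
    have r_nth: "?r $ i = q (p $ i) $ i" for i
      using p_in[of i] by (simp add: \<pi>_def)
    have r_grid: "?r \<in> grid v"
      using permutes_in_image[OF perm] p_in by (simp add: grid_def)
    have "A ?r = 1 \<longleftrightarrow> p $ 1 = p $ 2 \<and> p $ 2 = p $ 3"
    proof
      assume "A ?r = 1"
      \<comment> \<open>The ones at \<open>?r\<close> and \<open>q (p $ i)\<close> share coordinate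
        \<open>i\<close>. Once they coincide for every \<open>i\<close>, the first coordinate of
        \<open>?r\<close> equals each \<open>p $ i\<close>.\<close>
      then have "?r = q (p $ i)" for i
        using same r_grid q_grid[OF p_in] q(2)[OF p_in] r_nth by blast
      then have "?r $ 1 = p $ i" for i
        using q_1[OF p_in] by metis
      then show "p $ 1 = p $ 2 \<and> p $ 2 = p $ 3"
        by metis
    next
      assume "p $ 1 = p $ 2 \<and> p $ 2 = p $ 3"
      then have "\<forall>i. p $ i = p $ 1"
        by (simp add: forall_3)
      then have "?r = q (p $ 1)"
        using r_nth by (metis vec_eq_iff)
      then show "A ?r = 1"
        using q(2)[OF p_in] by metis
    qed
    \<comment> \<open>Off the diagonal the entry is so far only known to differ from 1.\<close>
    moreover have "A ?r \<in> {0, 1}"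
      using A r_grid by (rule PiE_mem)
    ultimately show ?thesis
      by auto
  qed
  have "diagonal_cube v = isotope v \<pi> (conjugate v id A)"
    unfolding conjugate_id[OF A] diagonal_cube_def isotope_def
    using ones by (intro restrict_ext) simp
  then show ?thesis
    unfolding equivalent_def using perm permutes_id by blast
qed

end
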